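(* There exists a Borel measure $\mu$ on $X=[0,\infty)$, finite on bounded sets, with nonempty support and absolutely continuous with respect to Lebesgue measure, such that: (1) $\limsup_{\lambda\to 0^+}\lambda\,\mu(\{x\in X: |M_\mu\delta_2(x)|>\lambda\})>e^{-1}$; (2) $\liminf_{\lambda\to 0^+}\lambda\,\mu(\{x\in X: |M_\mu\delta_2(x)|>\lambda\})=e^{-1}$; (3) $\lim_{\lambda\to 0^+}\lambda\,\mu(\{x\in X: |M_\mu\delta_0(x)|>\lambda\})=e^{-1}$. Here $e$ is the base of the natural logarithm.
   Context: Measures are nonnegative. $X=[0,\infty)$ carries the Euclidean metric, $B(x,r)=\{y\in X:|x-y|\le r\}$ denotes the closed ball, and $\delta_y$ is the Dirac measure at $y$. The centered maximal operator of a finite Borel measure $\nu$ on $X$ is $$M_\mu\nu(x)=\sup_{r>r_0(x)}\frac{\nu(B(x,r))}{\mu(B(x,r))},\qquad r_0(x)=\inf\{r>0:\mu(B(x,r))>0\}.$$ *)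

theory Defs
  imports "HOL-Probability.Probability"
begin

abbreviation half_line :: "real measure" where
  "half_line \<equiv> restrict_space borel {0..}"

definition half_ball :: "real \<Rightarrow> real \<Rightarrow> real set" where
  "half_ball x r = {y \<in> {0..}. \<bar>x - y\<bar> \<le> r}"

definition measure_support :: "real measure \<Rightarrow> real set" where
  "measure_support \<mu> = {x \<in> {0..}. \<forall>r>0. 0 < emeasure \<mu> (half_ball x r)}"

(* The infimum is taken over a nonempty set, hence is not a junk value, as soon as
   the support of \<mu> is nonempty. *)
definition r0 :: "real measure \<Rightarrow> real \<Rightarrow> real" where
  "r0 \<mu> x = Inf {r. 0 < r \<and> 0 < emeasure \<mu> (half_ball x r)}"

(* Values are in ennreal, since the supremum may be infinite.
   For finite \<nu> and \<mu> finite on bounded sets, the numerator and denominator are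
   right-continuous in r, so rational radii suffice and the function is Borel;
   emeasure of its superlevel sets is therefore never the default value 0 of a
   non-measurable set. *)
definition maximal_op :: "real measure \<Rightarrow> real measure \<Rightarrow> real \<Rightarrow> ennreal" where
  "maximal_op \<mu> \<nu> x =
     (SUP r\<in>{r0 \<mu> x<..}. emeasure \<nu> (half_ball x r) / emeasure \<mu> (half_ball x r))"

definition weak_type_quantity :: "real measure \<Rightarrow> real measure \<Rightarrow> real \<Rightarrow> ennreal" where
  "weak_type_quantity \<mu> \<nu> l =
     ennreal l * emeasure \<mu> {x \<in> {0..}. maximal_op \<mu> \<nu> x > ennreal l}"

end

theory Submission imports Defs "HOL-Real_Asymp.Real_Asymp" begin

text \<open>
  Let \<open>F x = \<mu> [0, x]\<close> be strictly increasing and continuous. Since the best radius in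
  \<open>M\<^sub>\<mu> \<delta>\<^sub>y (x)\<close> is \<open>\<bar>x - y\<bar>\<close>, the weak type quantity of \<open>\<delta>\<^sub>0\<close> at level \<open>1 / F s\<close> is
  \<open>F (s / 2) / F s\<close>, and that of \<open>\<delta>\<^sub>2\<close> at level \<open>1 / (F s - F 2)\<close> is
  \<open>F (1 + s / 2) / (F s - F 2)\<close>. So \<open>F\<close> has to satisfy \<open>F (2 x) / F x \<rightarrow> e\<close> while growing by a fixed
  factor on the unit intervals \<open>[2\<^sup>k, 2\<^sup>k + 1]\<close>. A jump at \<open>2\<^sup>k\<close> spread evenly on a logarithmic scale
  in \<open>x - 2\<^sup>k\<close>, over a range of scales of length proportional to \<open>k\<close>, achieves both: doubling
  \<open>x\<close> only shifts it by a bounded amount of that scale, an error of order \<open>1 / k\<close>. The sequence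
  \<open>s = 2 \<cdot> 2\<^sup>k\<close> then sees the jump, and \<open>s = 2 (2\<^sup>k - 1)\<close> does not.
\<close>

section \<open>Dirac masses and superlevel sets\<close>

lemma half_ball_sets [measurable]: "half_ball x r \<in> sets half_line"
proof -
  have "half_ball x r = {x - r..x + r} \<inter> {0..}"
    by (auto simp: half_ball_def abs_le_iff)
  then show ?thesis
    by (auto simp: sets_restrict_space)
qed

lemma half_ball_mono: "r \<le> s \<Longrightarrow> half_ball x r \<subseteq> half_ball x s"
  by (auto simp: half_ball_def)

lemma ennreal_inverse_antimono: "a \<le> b \<Longrightarrow> inverse b \<le> inverse (a :: ennreal)"
  including ennreal.lifting by transfer (rule ereal_inverse_antimono)

text \<open>The numerator jumps from 0 to 1 at radius \<open>\<bar>x - y\<bar>\<close> and the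
  denominator grows with the radius, so the smallest radius reaching \<open>y\<close> is optimal.
  For \<open>x = y\<close> it would be 0, which the supremum excludes.\<close>

lemma maximal_op_dirac:
  assumes sets: "sets \<mu> = sets half_line"
    and pos: "\<And>r. r > 0 \<Longrightarrow> 0 < emeasure \<mu> (half_ball x r)"
    and xy: "y \<ge> 0" "x \<noteq> y"
  shows "maximal_op \<mu> (return half_line y) x = 1 / emeasure \<mu> (half_ball x \<bar>x - y\<bar>)"
proof -
  have "{r. 0 < r \<and> 0 < emeasure \<mu> (half_ball x r)} = {0<..}"
    using pos by auto
  then have r0: "r0 \<mu> x = 0"
    by (simp add: r0_def)
  have ret: "emeasure (return half_line y) (half_ball x r) = (if \<bar>x - y\<bar> \<le> r then 1 else 0)" for r
    using xy half_ball_sets[of x r] by (simp add: half_ball_def indicator_def)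
  show ?thesis
    unfolding maximal_op_def r0 ret
  proof (rule antisym)
    show "(SUP r\<in>{0<..}. (if \<bar>x - y\<bar> \<le> r then 1 else 0) / emeasure \<mu> (half_ball x r))
        \<le> 1 / emeasure \<mu> (half_ball x \<bar>x - y\<bar>)"
    proof (rule SUP_least)
      fix r :: real assume "r \<in> {0<..}"
      show "(if \<bar>x - y\<bar> \<le> r then 1 else 0) / emeasure \<mu> (half_ball x r)
          \<le> 1 / emeasure \<mu> (half_ball x \<bar>x - y\<bar>)"
      proof (cases "\<bar>x - y\<bar> \<le> r")
        case True
        have "emeasure \<mu> (half_ball x \<bar>x - y\<bar>) \<le> emeasure \<mu> (half_ball x r)"
          by (intro emeasure_mono half_ball_mono True) (simp add: sets half_ball_sets)
        then show ?thesis
          using True by (simp add: divide_ennreal_def ennreal_inverse_antimono)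
      qed simp
    qed
    show "1 / emeasure \<mu> (half_ball x \<bar>x - y\<bar>)
        \<le> (SUP r\<in>{0<..}. (if \<bar>x - y\<bar> \<le> r then 1 else 0) / emeasure \<mu> (half_ball x r))"
      by (rule SUP_upper2[where i = "\<bar>x - y\<bar>"]) (use xy in auto)
  qed
qed

text \<open>Turns superlevel sets of the maximal function into sublevel sets of ball masses,
  including mass 0, where \<open>1 / m\<close> is infinite.\<close>

lemma less_one_divide_ennreal_iff:
  assumes "T > 0"
  shows "ennreal (1 / T) < 1 / m \<longleftrightarrow> m < ennreal T"
proof (cases m rule: ennreal_cases)
  case (real r)
  show ?thesis
  proof (cases "r = 0")
    case True
    then show ?thesis using real assms by (simp add: divide_ennreal_def less_top[symmetric])
  next
    case False
    then have "r > 0" using real by simp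
    then have "1 / m = ennreal (1 / r)"
      using real divide_ennreal[of 1 r] by simp
    then show ?thesis
      using \<open>r > 0\<close> assms real by (simp add: ennreal_less_iff field_simps)
  qed
qed simp

lemma emeasure_eq_off_point:
  assumes "{y} \<in> null_sets M" "B \<in> sets M" "A - {y} = B - {y}"
  shows "emeasure M A = emeasure M B"
proof (rule emeasure_eq_AE)
  have "A = B - {y} \<or> A = insert y (B - {y})"
    using assms(3) by blast
  moreover have "B - {y} \<in> sets M"
    using assms(1,2) by auto
  moreover have "insert y (B - {y}) \<in> sets M"
    using assms(1) \<open>B - {y} \<in> sets M\<close> by (rule sets.insert_in_sets[OF null_setsD2])
  ultimately show "A \<in> sets M" by auto
  show "AE x in M. x \<in> A \<longleftrightarrow> x \<in> B"
    using assms(3) by (intro AE_I'[OF assms(1)]) auto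
qed (use assms in auto)

text \<open>Every infimum over a set of the filter lies eventually below the values along
  \<open>g\<close>, so one sequence of levels suffices for an upper bound.\<close>

lemma Liminf_le_of_tendsto:
  fixes f :: "'a \<Rightarrow> 'b :: {complete_linorder, linorder_topology}"
  assumes "filterlim g F G" "((\<lambda>n. f (g n)) \<longlongrightarrow> L) G" "G \<noteq> bot"
  shows "Liminf F f \<le> L"
proof (rule Liminf_least)
  fix P assume "eventually P F"
  then have "eventually (\<lambda>n. P (g n)) G"
    using assms(1) by (rule eventually_compose_filterlim)
  then have "eventually (\<lambda>n. (INF x\<in>Collect P. f x) \<le> f (g n)) G"
    by eventually_elim (auto intro: INF_lower)
  then show "(INF x\<in>Collect P. f x) \<le> L"
    by (rule tendsto_lowerbound[OF assms(2) _ assms(3)])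
qed

lemma Limsup_ge_of_tendsto:
  fixes f :: "'a \<Rightarrow> 'b :: {complete_linorder, linorder_topology}"
  assumes "filterlim g F G" "((\<lambda>n. f (g n)) \<longlongrightarrow> L) G" "G \<noteq> bot"
  shows "L \<le> Limsup F f"
proof (rule Limsup_greatest)
  fix P assume "eventually P F"
  then have "eventually (\<lambda>n. P (g n)) G"
    using assms(1) by (rule eventually_compose_filterlim)
  then have "eventually (\<lambda>n. f (g n) \<le> (SUP x\<in>Collect P. f x)) G"
    by eventually_elim (auto intro: SUP_upper)
  then show "L \<le> (SUP x\<in>Collect P. f x)"
    by (rule tendsto_upperbound[OF assms(2) _ assms(3)])
qed

section \<open>The measure\<close>

text \<open>
  The function \<open>piece k\<close> climbs from \<open>exp k\<close> at \<open>2 ^ k\<close> to \<open>exp (k + 1)\<close> at \<open>2 ^ (k + 1)\<close>.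
  In terms of \<open>t = x - 2 ^ k\<close> it runs logarithmically through the scales between \<open>4 ^ (- k)\<close>
  and \<open>2 ^ k\<close>, and those below \<open>1\<close> account for about two thirds of the increase.
\<close>

definition dyadic_level :: "real \<Rightarrow> nat" where
  "dyadic_level x = nat \<lfloor>log 2 x\<rfloor>"

definition piece :: "nat \<Rightarrow> real \<Rightarrow> real" where
  "piece k x = exp k * (1 + (exp 1 - 1) * (ln (1 + 4 ^ k * (x - 2 ^ k)) / ln (1 + 8 ^ k)))"

definition piece_deriv :: "nat \<Rightarrow> real \<Rightarrow> real" where
  "piece_deriv k x = exp k * (exp 1 - 1) * 4 ^ k / (ln (1 + 8 ^ k) * (1 + 4 ^ k * (x - 2 ^ k)))"

text \<open>The function \<open>F\<close>. Its linear start approaches 1, the initial value of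
  \<open>piece 0\<close>.\<close>

definition cdf_fun :: "real \<Rightarrow> real" where
  "cdf_fun x = (if x < 1 then x else piece (dyadic_level x) x)"

text \<open>At powers of 2 the density follows the piece to the right; the choice affects only a
  null set.\<close>

definition dens :: "real \<Rightarrow> real" where
  "dens x = (if x < 1 then 1 else piece_deriv (dyadic_level x) x)"

definition dyadic_measure :: "real measure" where
  "dyadic_measure = density (restrict_space lborel {0..}) (\<lambda>x. ennreal (dens x))"

section \<open>Dyadic intervals and the gluing of the pieces\<close>

lemma dyadic_level_eq:
  assumes "2 ^ k \<le> x" "x < 2 ^ Suc k"
  shows "dyadic_level x = k"
proof -
  have "x > 0" using assms(1) by (smt (verit) zero_less_power)
  then have "real k \<le> log 2 x" "log 2 x < real k + 1"
    using assms by (simp_all add: le_log_iff log_less_iff powr_realpow powr_add)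
  then have "\<lfloor>log 2 x\<rfloor> = int k" by linarith
  then show ?thesis by (simp add: dyadic_level_def)
qed

lemma dyadic_level_bounds:
  assumes "1 \<le> x"
  shows "2 ^ dyadic_level x \<le> x" "x < 2 ^ Suc (dyadic_level x)"
proof -
  have "log 2 x \<ge> 0" using assms by simp
  then have "real (dyadic_level x) \<le> log 2 x" "log 2 x < real (Suc (dyadic_level x))"
    unfolding dyadic_level_def by linarith+
  then show "2 ^ dyadic_level x \<le> x" "x < 2 ^ Suc (dyadic_level x)"
    using assms by (simp_all add: le_log_iff log_less_iff powr_realpow powr_add)
qed

lemma ln_one_plus_power_pos: "ln (1 + 8 ^ k :: real) > 0"
  by (intro ln_gt_zero) simp

lemma piece_left: "piece k (2 ^ k) = exp k"
  by (simp add: piece_def)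

text \<open>The normalisation \<open>ln (1 + 8 ^ k)\<close> is the logarithm reached at the right
  end, as \<open>4 ^ k * 2 ^ k = 8 ^ k\<close>; neighbouring pieces therefore join
  continuously.\<close>

lemma piece_right: "piece k (2 ^ Suc k) = exp (Suc k)"
proof -
  have "4 ^ k * (2 ^ Suc k - 2 ^ k) = (8 ^ k :: real)"
    by (simp flip: power_mult_distrib)
  then show ?thesis
    using ln_one_plus_power_pos[of k] by (simp add: piece_def exp_add)
qed

text \<open>At the right endpoint \<open>dyadic_level\<close> is already \<open>Suc k\<close>, but
  both pieces have the same value there.\<close>

lemma cdf_fun_piece:
  assumes "2 ^ k \<le> x" "x \<le> 2 ^ Suc k"
  shows "cdf_fun x = piece k x"
proof (cases "x = 2 ^ Suc k")
  case True
  have "dyadic_level x = Suc k" by (rule dyadic_level_eq) (simp_all add: True)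
  moreover have "x \<ge> 1" using True one_le_power[of "2::real" "Suc k"] by simp
  ultimately show ?thesis using piece_right[of k] piece_left[of "Suc k"] True
    by (simp add: cdf_fun_def)
next
  case False
  then have "dyadic_level x = k" using assms by (intro dyadic_level_eq) auto
  moreover have "x \<ge> 1" using assms one_le_power[of "2::real" k] by linarith
  ultimately show ?thesis by (simp add: cdf_fun_def)
qed

lemma cdf_fun_power: "cdf_fun (2 ^ k) = exp k"
  using cdf_fun_piece[of k "2 ^ k"] by (simp add: piece_left)

lemma piece_arg_ge:
  assumes "(2::real) ^ k \<le> x"
  shows "1 + 4 ^ k * (x - 2 ^ k) \<ge> 1"
  using assms by simp

lemma piece_has_derivative:
  assumes "2 ^ k \<le> x"
  shows "(piece k has_real_derivative piece_deriv k x) (at x)"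
proof -
  have [simp]: "ln (1 + 8 ^ k :: real) \<noteq> 0" using ln_one_plus_power_pos[of k] by simp
  show ?thesis
    unfolding piece_def piece_deriv_def using piece_arg_ge[OF assms]
    by (auto intro!: derivative_eq_intros simp: mult_ac)
qed

lemma piece_deriv_pos:
  assumes "2 ^ k \<le> x"
  shows "piece_deriv k x > 0"
  unfolding piece_deriv_def using piece_arg_ge[OF assms] ln_one_plus_power_pos[of k]
  by (intro divide_pos_pos mult_pos_pos) auto

lemma dens_pos: "dens x > 0"
  by (auto simp: dens_def intro!: piece_deriv_pos dyadic_level_bounds)

lemma piece_deriv_measurable [measurable]: "piece_deriv k \<in> borel_measurable borel"
  unfolding piece_deriv_def by measurable

lemma dens_measurable [measurable]: "dens \<in> borel_measurable borel"
proof -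
  have [measurable]: "dyadic_level \<in> borel \<rightarrow>\<^sub>M count_space UNIV"
    unfolding dyadic_level_def by measurable
  have "(\<lambda>x. piece_deriv (dyadic_level x) x) \<in> borel_measurable borel"
    by (rule measurable_compose_countable) measurable
  then show ?thesis
    unfolding dens_def by measurable
qed

section \<open>Masses of intervals\<close>

lemma sets_dyadic_measure [measurable_cong]: "sets dyadic_measure = sets half_line"
  by (simp add: dyadic_measure_def sets_restrict_space)

lemma emeasure_dyadic_measure:
  assumes "A \<in> sets borel" "A \<subseteq> {0..}"
  shows "emeasure dyadic_measure A = (\<integral>\<^sup>+ x. ennreal (dens x) * indicator A x \<partial>lborel)"
proof -
  have "A \<in> sets (restrict_space lborel {0..})"
    using assms by (auto simp: sets_restrict_space)
  then have "emeasure dyadic_measure A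
      = (\<integral>\<^sup>+ x. ennreal (dens x) * indicator A x \<partial>restrict_space lborel {0..})"
    unfolding dyadic_measure_def
    by (intro emeasure_density) (auto intro!: measurable_restrict_space1)
  also have "\<dots> = (\<integral>\<^sup>+ x. ennreal (dens x) * indicator A x * indicator {0..} x \<partial>lborel)"
    by (simp add: nn_integral_restrict_space)
  also have "\<dots> = (\<integral>\<^sup>+ x. ennreal (dens x) * indicator A x \<partial>lborel)"
    using assms(2) by (intro nn_integral_cong) (auto simp: indicator_def)
  finally show ?thesis .
qed

lemma borel_half_line_sets: "A \<in> sets borel \<Longrightarrow> A \<subseteq> {0..} \<Longrightarrow> A \<in> sets dyadic_measure"
  by (auto simp: sets_dyadic_measure sets_restrict_space)

lemma singleton_null_dyadic_measure: "0 \<le> y \<Longrightarrow> {y} \<in> null_sets dyadic_measure"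
  by (intro null_setsI)
    (auto simp: emeasure_dyadic_measure nn_integral_indicator_singleton intro: borel_half_line_sets)

lemma emeasure_dyadic_piece:
  assumes "2 ^ k \<le> x" "x \<le> 2 ^ Suc k"
  shows "emeasure dyadic_measure {2 ^ k<..x} = ennreal (cdf_fun x - exp k)"
proof -
  have "(0::real) < 2 ^ k" by simp
  then have "{2 ^ k<..x} \<subseteq> {0..}" by (smt (verit) atLeast_iff greaterThanAtMost_iff subsetI)
  then have "emeasure dyadic_measure {2 ^ k<..x}
      = (\<integral>\<^sup>+ t. ennreal (dens t) * indicator {2 ^ k<..x} t \<partial>lborel)"
    by (intro emeasure_dyadic_measure) auto
  also have "\<dots> = (\<integral>\<^sup>+ t. ennreal (piece_deriv k t) * indicator {2 ^ k..x} t \<partial>lborel)"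
  proof (rule nn_integral_cong_AE)
    have dens: "dens t = piece_deriv k t" if "2 ^ k < t" "t < 2 ^ Suc k" for t
    proof -
      have "t \<ge> 1" using that one_le_power[of "2::real" k] by linarith
      moreover have "dyadic_level t = k" using that by (intro dyadic_level_eq) auto
      ultimately show ?thesis by (simp add: dens_def)
    qed
    \<comment> \<open>The indicators differ at \<open>2 ^ k\<close>, and the densities can differ at
      \<open>2 ^ Suc k\<close>; these two points are discarded.\<close>
    show "AE t in lborel. ennreal (dens t) * indicator {2 ^ k<..x} t
        = ennreal (piece_deriv k t) * indicator {2 ^ k..x} t"
      using AE_lborel_singleton[of "2 ^ k::real"] AE_lborel_singleton[of "2 ^ Suc k::real"]
      by eventually_elim (use assms dens in \<open>auto simp: indicator_def\<close>)
  qed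
  also have "\<dots> = ennreal (piece k x - piece k (2 ^ k))"
    by (intro nn_integral_FTC_Icc)
      (use assms in \<open>auto intro: piece_has_derivative less_imp_le piece_deriv_pos\<close>)
  finally show ?thesis
    using cdf_fun_piece[OF assms] by (simp add: piece_left)
qed

lemma cdf_fun_ge_exp:
  assumes "2 ^ k \<le> x" "x \<le> 2 ^ Suc k"
  shows "cdf_fun x \<ge> exp k"
  using piece_arg_ge[OF assms(1)] ln_one_plus_power_pos[of k]
  by (simp add: cdf_fun_piece[OF assms] piece_def)

lemma emeasure_dyadic_split:
  assumes "0 \<le> a" "a \<le> b"
  shows "emeasure dyadic_measure {0..b}
    = emeasure dyadic_measure {0..a} + emeasure dyadic_measure {a<..b}"
proof -
  have "{0..b} = {0..a} \<union> {a<..b}" using assms by auto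
  then show ?thesis
    using assms by (simp, intro plus_emeasure[symmetric] borel_half_line_sets) auto
qed

lemma emeasure_dyadic_power: "emeasure dyadic_measure {0..2 ^ k} = ennreal (exp k)"
proof (induction k)
  case 0
  have "emeasure dyadic_measure {0..1} = (\<integral>\<^sup>+ x. ennreal (dens x) * indicator {0..1} x \<partial>lborel)"
    by (intro emeasure_dyadic_measure) auto
  \<comment> \<open>At 1 the density already belongs to \<open>piece 0\<close>, so the integrands
    agree only almost everywhere.\<close>
  also have "\<dots> = (\<integral>\<^sup>+ x. indicator {0..1::real} x \<partial>lborel)"
    by (intro nn_integral_cong_AE eventually_mono[OF AE_lborel_singleton[of 1]])
      (auto simp: dens_def indicator_def)
  finally show ?case by simp
next
  case (Suc k)
  show ?case
    using emeasure_dyadic_split[of "2 ^ k" "2 ^ Suc k"] emeasure_dyadic_piece[of k "2 ^ Suc k"] Suc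
    by (simp add: cdf_fun_power[of "Suc k", simplified] flip: ennreal_plus)
qed

text \<open>The mass \<open>exp k\<close> up to the last power of 2 is completed by part of one
  piece, which identifies \<open>cdf_fun\<close> as the distribution function.\<close>

lemma emeasure_dyadic_Icc0:
  assumes "0 \<le> x"
  shows "emeasure dyadic_measure {0..x} = ennreal (cdf_fun x)"
proof (cases "x < 1")
  case True
  have "emeasure dyadic_measure {0..x} = (\<integral>\<^sup>+ t. ennreal (dens t) * indicator {0..x} t \<partial>lborel)"
    by (intro emeasure_dyadic_measure) auto
  also have "\<dots> = (\<integral>\<^sup>+ t. indicator {0..x} t \<partial>lborel)"
    using True by (intro nn_integral_cong) (auto simp: dens_def indicator_def)
  finally show ?thesis using True assms by (simp add: cdf_fun_def)
next
  case False
  define k where "k = dyadic_level x"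
  have k: "2 ^ k \<le> x" "x \<le> 2 ^ Suc k"
    using False dyadic_level_bounds[of x] by (auto simp: k_def)
  show ?thesis
    using emeasure_dyadic_split[of "2 ^ k" x] emeasure_dyadic_piece[OF k] k cdf_fun_ge_exp[OF k]
    by (simp add: emeasure_dyadic_power flip: ennreal_plus)
qed

lemma cdf_fun_nonneg: "0 \<le> x \<Longrightarrow> 0 \<le> cdf_fun x"
  using dyadic_level_bounds[of x] cdf_fun_ge_exp[of "dyadic_level x" x] by (cases "x < 1")
    (auto simp: cdf_fun_def[of x] intro: order_trans[OF exp_ge_zero])

lemma emeasure_dyadic_Ioc:
  assumes "0 \<le> a" "a \<le> b"
  shows "emeasure dyadic_measure {a<..b} = ennreal (cdf_fun b - cdf_fun a)"
proof -
  have "{a<..b} = {0..b} - {0..a}" using assms by auto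
  then have "emeasure dyadic_measure {a<..b}
      = emeasure dyadic_measure {0..b} - emeasure dyadic_measure {0..a}"
    using assms by (simp, intro emeasure_Diff borel_half_line_sets)
      (auto simp: emeasure_dyadic_Icc0 intro!: borel_half_line_sets)
  then show ?thesis
    using assms by (simp add: emeasure_dyadic_Icc0 ennreal_minus cdf_fun_nonneg)
qed

lemma emeasure_dyadic_Icc:
  assumes "0 \<le> a" "a \<le> b"
  shows "emeasure dyadic_measure {a..b} = ennreal (cdf_fun b - cdf_fun a)"
proof -
  have "emeasure dyadic_measure {a..b} = emeasure dyadic_measure {a<..b}"
  proof (rule emeasure_eq_off_point[OF singleton_null_dyadic_measure[OF assms(1)]])
    show "{a<..b} \<in> sets dyadic_measure"
      using assms by (intro borel_half_line_sets) auto
  qed auto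
  then show ?thesis using assms by (simp add: emeasure_dyadic_Ioc)
qed

lemma emeasure_dyadic_Ico0:
  assumes "0 \<le> b"
  shows "emeasure dyadic_measure {0..<b} = ennreal (cdf_fun b)"
proof -
  have "emeasure dyadic_measure {0..<b} = emeasure dyadic_measure {0..b}"
  proof (rule emeasure_eq_off_point[OF singleton_null_dyadic_measure[OF assms]])
    show "{0..b} \<in> sets dyadic_measure"
      by (intro borel_half_line_sets) auto
  qed auto
  then show ?thesis using assms by (simp add: emeasure_dyadic_Icc0)
qed

text \<open>Otherwise \<open>{a<..b}\<close> would have mass 0, although the density is positive and
  the interval has positive length.\<close>

lemma cdf_fun_strict_mono:
  assumes "0 \<le> a" "a < b"
  shows "cdf_fun a < cdf_fun b"
proof (rule ccontr)
  assume "\<not> ?thesis"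
  then have "emeasure dyadic_measure {a<..b} = 0"
    using assms by (simp add: emeasure_dyadic_Ioc ennreal_neg)
  moreover have "emeasure dyadic_measure {a<..b}
      = (\<integral>\<^sup>+ t. ennreal (dens t) * indicator {a<..b} t \<partial>lborel)"
    using assms by (intro emeasure_dyadic_measure) auto
  moreover have nz: "ennreal (dens t) \<noteq> 0" for t
    using dens_pos[of t] by (simp add: ennreal_eq_0_iff not_le)
  ultimately have "AE t in lborel. ennreal (dens t) * indicator {a<..b} t = 0"
    by (intro nn_integral_0_iff_AE[THEN iffD1]) auto
  then have "AE t in lborel. t \<notin> {a<..b}"
    by eventually_elim (use nz in \<open>auto simp: indicator_def split: if_splits\<close>)
  then have "{a<..b} \<in> null_sets lborel"
    by (subst AE_iff_null_sets) auto
  then have "emeasure lborel {a<..b} = 0" by auto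
  with assms show False by simp
qed

lemma cdf_fun_less_iff: "0 \<le> a \<Longrightarrow> 0 \<le> b \<Longrightarrow> cdf_fun a < cdf_fun b \<longleftrightarrow> a < b"
  using cdf_fun_strict_mono[of a b] cdf_fun_strict_mono[of b a] by (cases a b rule: linorder_cases) auto

text \<open>Since \<open>cdf_fun (2 ^ k) = exp k\<close>, the dyadic interval containing a solution
  is read off from \<open>ln T\<close>; the intermediate value theorem applies on it.\<close>

lemma cdf_fun_attains:
  assumes "T \<ge> 1"
  obtains s where "s \<ge> 1" "cdf_fun s = T"
proof -
  define k where "k = nat \<lfloor>ln T\<rfloor>"
  have "real k \<le> ln T" "ln T \<le> Suc k"
    using assms unfolding k_def by (simp_all) linarith
  then have T: "exp k \<le> T" "T \<le> exp (Suc k)"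
    using assms exp_le_cancel_iff[of "ln T" "Suc k"] by (simp_all add: ln_ge_iff del: of_nat_Suc exp_le_cancel_iff)
  have "\<exists>s\<ge>2 ^ k. s \<le> 2 ^ Suc k \<and> piece k s = T"
  proof (rule IVT')
    show "continuous_on {2 ^ k..2 ^ Suc k} (piece k)"
      by (intro continuous_at_imp_continuous_on ballI DERIV_isCont[OF piece_has_derivative]) auto
  qed (use T in \<open>auto simp: piece_left piece_right simp del: power_Suc of_nat_Suc\<close>)
  then obtain s where s: "2 ^ k \<le> s" "s \<le> 2 ^ Suc k" "piece k s = T" by blast
  show ?thesis
    using s cdf_fun_piece[of k s] order_trans[OF one_le_power[of "2::real" k] s(1)]
    by (intro that[of s]) auto
qed

section \<open>Asymptotics of the distribution function\<close>

text \<open>Passing from \<open>x\<close> to \<open>2 * x\<close> multiplies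
  \<open>u = 4 ^ k * (x - 2 ^ k)\<close> by exactly 8. Logarithms and normalisations thus shift by
  at most \<open>ln 8\<close>, while the normalisation is at least \<open>k * ln 8\<close>, so the
  fraction of the piece covered changes by at most \<open>1 / k\<close>.\<close>

lemma cdf_fun_double_bound:
  assumes "2 ^ k \<le> x" "x \<le> 2 ^ Suc k" "k > 0"
  shows "\<bar>cdf_fun (2 * x) / cdf_fun x - exp 1\<bar> \<le> exp 1 * (exp 1 - 1) / k"
proof -
  define u where "u = 4 ^ k * (x - 2 ^ k)"
  define a where "a = ln (1 + u)"
  define a' where "a' = ln (1 + 8 * u)"
  define b where "b = ln (1 + 8 ^ k :: real)"
  define b' where "b' = ln (1 + 8 ^ Suc k :: real)"
  have u: "0 \<le> u" using assms by (simp add: u_def)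
  have "x - 2 ^ k \<le> 2 ^ k" using assms by simp
  then have "u \<le> 4 ^ k * 2 ^ k" unfolding u_def by (intro mult_left_mono) auto
  then have u8: "u \<le> 8 ^ k" by (simp flip: power_mult_distrib)
  \<comment> \<open>Used with \<open>v = u\<close> for the numerators and with
    \<open>v = 8 ^ k\<close> for the normalisations.\<close>
  have step: "ln (1 + v) \<le> ln (1 + 8 * v)" "ln (1 + 8 * v) \<le> ln (1 + v) + ln 8"
    if "v \<ge> 0" for v :: real
  proof -
    show "ln (1 + v) \<le> ln (1 + 8 * v)" using that by simp
    have "ln (1 + 8 * v) \<le> ln (8 * (1 + v))" using that by (intro ln_mono) auto
    then show "ln (1 + 8 * v) \<le> ln (1 + v) + ln 8" using that by (subst (asm) ln_mult) auto
  qed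
  have a: "0 \<le> a" "a \<le> b" "a \<le> a'" "a' \<le> a + ln 8" "b \<le> b'" "b' \<le> b + ln 8" "a' \<le> b'"
    using u u8 step[of u] step[of "8 ^ k"] by (auto simp: a_def a'_def b_def b'_def)
  have "k * ln 8 = ln (8 ^ k :: real)" by (simp add: ln_realpow)
  also have "\<dots> \<le> b" unfolding b_def by (rule ln_mono) auto
  finally have kb: "k * ln 8 \<le> b" .
  have b: "b > 0" "b' > 0" using a ln_one_plus_power_pos[of k] by (auto simp: b_def)
  have l8: "ln 8 / b \<le> 1 / k"
    using kb b assms(3) by (simp add: field_simps)
  have up: "a' / b' - a / b \<le> 1 / k"
  proof -
    have "a' / b' \<le> (a + ln 8) / b" using a b by (intro frac_le) auto
    then show ?thesis using l8 by (simp add: add_divide_distrib)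
  qed
  have low: "a / b - a' / b' \<le> 1 / k"
  proof -
    \<comment> \<open>In this direction only the change of normalisation counts, and its relative
      size is at most \<open>ln 8 / b\<close>.\<close>
    have "a / b - a' / b' \<le> a / b - a / b'" using a b by (simp add: divide_right_mono)
    also have "\<dots> = (a / b) * ((b' - b) / b')" using b by (simp add: field_simps)
    also have "\<dots> \<le> 1 * (ln 8 / b)" using a b by (intro mult_mono frac_le) auto
    finally show ?thesis using l8 by simp
  qed
  have F: "cdf_fun x = exp k * (1 + (exp 1 - 1) * (a / b))"
    using cdf_fun_piece[OF assms(1,2)] by (simp add: piece_def a_def b_def u_def)
  have "4 ^ Suc k * (2 * x - 2 ^ Suc k) = 8 * u" by (simp add: u_def algebra_simps)
  moreover have "cdf_fun (2 * x) = piece (Suc k) (2 * x)"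
    using assms by (intro cdf_fun_piece) auto
  ultimately have F2: "cdf_fun (2 * x) = exp k * exp 1 * (1 + (exp 1 - 1) * (a' / b'))"
    by (simp add: piece_def a'_def b'_def exp_add mult_ac del: power_Suc)
  define q where "q = 1 + (exp 1 - 1) * (a / b)"
  have q: "q \<ge> 1" using a b by (simp add: q_def)
  have "cdf_fun (2 * x) / cdf_fun x - exp 1
      = exp 1 * (1 + (exp 1 - 1) * (a' / b')) / q - exp 1"
    unfolding F F2 q_def[symmetric] by simp
  also have "\<dots> = exp 1 * ((1 + (exp 1 - 1) * (a' / b')) - q) / q"
    using q by (simp add: field_simps)
  also have "\<dots> = exp 1 * (exp 1 - 1) * (a' / b' - a / b) / q"
    unfolding q_def by (simp add: algebra_simps)
  finally have eq: "cdf_fun (2 * x) / cdf_fun x - exp 1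
      = exp 1 * (exp 1 - 1) * (a' / b' - a / b) / q" .
  have "\<bar>cdf_fun (2 * x) / cdf_fun x - exp 1\<bar> = exp 1 * (exp 1 - 1) * \<bar>a' / b' - a / b\<bar> / q"
    unfolding eq using q by (simp add: abs_mult)
  also have "\<dots> \<le> exp 1 * (exp 1 - 1) * (1 / k) / 1"
    using q up low by (intro frac_le mult_left_mono) (auto simp: abs_le_iff)
  finally show ?thesis by simp
qed

text \<open>The level is at least \<open>log 2 x - 1\<close>, which is positive from 4 on, so the
  error \<open>1 / k\<close> vanishes at infinity.\<close>

lemma cdf_fun_double_limit: "((\<lambda>x. cdf_fun (2 * x) / cdf_fun x) \<longlongrightarrow> exp 1) at_top"
proof (rule tendsto_sandwich)
  let ?C = "exp 1 * (exp 1 - 1) :: real"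
  have "\<bar>cdf_fun (2 * x) / cdf_fun x - exp 1\<bar> \<le> ?C / (log 2 x - 1)" if "x \<ge> 4" for x
  proof -
    have "log 2 x \<ge> 2" using that by (simp add: le_log_iff)
    then have k: "log 2 x - 1 \<le> dyadic_level x" "log 2 x - 1 > 0"
      unfolding dyadic_level_def by linarith+
    then have "dyadic_level x > 0" by linarith
    have "\<bar>cdf_fun (2 * x) / cdf_fun x - exp 1\<bar> \<le> ?C / dyadic_level x"
      using that \<open>dyadic_level x > 0\<close> dyadic_level_bounds[of x] by (intro cdf_fun_double_bound) auto
    also have "\<dots> \<le> ?C / (log 2 x - 1)"
      using k by (intro divide_left_mono) auto
    finally show ?thesis .
  qed
  then have ev: "eventually (\<lambda>x. \<bar>cdf_fun (2 * x) / cdf_fun x - exp 1\<bar> \<le> ?C / (log 2 x - 1)) at_top"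
    by (intro eventually_mono[OF eventually_ge_at_top[of 4]]) auto
  show "eventually (\<lambda>x. exp 1 - ?C / (log 2 x - 1) \<le> cdf_fun (2 * x) / cdf_fun x) at_top"
    using ev by eventually_elim linarith
  show "eventually (\<lambda>x. cdf_fun (2 * x) / cdf_fun x \<le> exp 1 + ?C / (log 2 x - 1)) at_top"
    using ev by eventually_elim linarith
qed real_asymp+

lemma cdf_fun_half_limit: "((\<lambda>s. cdf_fun (s / 2) / cdf_fun s) \<longlongrightarrow> exp (- 1)) at_top"
proof -
  have "((\<lambda>x. inverse (cdf_fun (2 * x) / cdf_fun x)) \<longlongrightarrow> inverse (exp 1)) at_top"
    by (intro tendsto_inverse cdf_fun_double_limit) simp
  moreover have "filterlim (\<lambda>s::real. s / 2) at_top at_top"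
    by real_asymp
  ultimately have "((\<lambda>s. inverse (cdf_fun (2 * (s / 2)) / cdf_fun (s / 2))) \<longlongrightarrow> inverse (exp 1)) at_top"
    by (rule filterlim_compose)
  then show ?thesis by (simp add: exp_minus)
qed

section \<open>Weak type quantities\<close>

text \<open>The ball contains \<open>[x, x + r]\<close>, which stays in the half line even at
  \<open>x = 0\<close>. Hence \<open>r0\<close> vanishes on the half line.\<close>

lemma half_ball_dyadic_pos:
  assumes "x \<ge> 0" "r > 0"
  shows "0 < emeasure dyadic_measure (half_ball x r)"
proof -
  have "0 < emeasure dyadic_measure {x..x + r}"
    using assms cdf_fun_strict_mono[of x "x + r"] by (simp add: emeasure_dyadic_Icc)
  also have "\<dots> \<le> emeasure dyadic_measure (half_ball x r)"
  proof (rule emeasure_mono)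
    show "{x..x + r} \<subseteq> half_ball x r"
      using assms by (auto simp: half_ball_def)
  qed (simp add: sets_dyadic_measure half_ball_sets)
  finally show ?thesis .
qed

text \<open>The superlevel set is \<open>[0, c)\<close> up to the massless point \<open>y\<close>.
  The geometry of each Dirac mass enters through \<open>ball\<close>.\<close>

lemma weak_type_quantity_dyadic:
  assumes "T > 0" "y \<ge> 0" "c \<ge> 0"
    and ball: "\<And>x. x \<ge> 0 \<Longrightarrow> x \<noteq> y \<Longrightarrow>
      emeasure dyadic_measure (half_ball x \<bar>x - y\<bar>) < ennreal T \<longleftrightarrow> x < c"
  shows "weak_type_quantity dyadic_measure (return half_line y) (1 / T) = ennreal (cdf_fun c / T)"
proof -
  have "emeasure dyadic_measure
      {x \<in> {0..}. maximal_op dyadic_measure (return half_line y) x > ennreal (1 / T)}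
      = emeasure dyadic_measure {0..<c}"
  proof (rule emeasure_eq_off_point[OF singleton_null_dyadic_measure[OF assms(2)]])
    have "maximal_op dyadic_measure (return half_line y) x > ennreal (1 / T) \<longleftrightarrow> x < c"
      if "x \<ge> 0" "x \<noteq> y" for x
      using that assms(1,2)
      by (simp add: maximal_op_dirac sets_dyadic_measure half_ball_dyadic_pos
          less_one_divide_ennreal_iff ball)
    then show "{x \<in> {0..}. maximal_op dyadic_measure (return half_line y) x > ennreal (1 / T)} - {y}
        = {0..<c} - {y}"
      by auto
  qed (auto intro!: borel_half_line_sets)
  then show ?thesis
    using assms by (simp add: weak_type_quantity_def emeasure_dyadic_Ico0 cdf_fun_nonneg flip: ennreal_mult)
qed

lemma weak_type_quantity_dyadic_0:
  assumes "s > 0"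
  shows "weak_type_quantity dyadic_measure (return half_line 0) (1 / cdf_fun s)
    = ennreal (cdf_fun (s / 2) / cdf_fun s)"
proof (rule weak_type_quantity_dyadic)
  show pos: "cdf_fun s > 0"
    using cdf_fun_strict_mono[of 0 s] assms by (simp add: cdf_fun_def[of 0])
  fix x :: real assume x: "x \<ge> 0"
  then have "half_ball x \<bar>x - 0\<bar> = {0..2 * x}"
    by (auto simp: half_ball_def abs_le_iff)
  then show "emeasure dyadic_measure (half_ball x \<bar>x - 0\<bar>) < ennreal (cdf_fun s) \<longleftrightarrow> x < s / 2"
    using x assms pos
    by (auto simp: emeasure_dyadic_Icc0 ennreal_less_iff cdf_fun_nonneg cdf_fun_less_iff)
qed (use assms in auto)

text \<open>For \<open>x > 2\<close> the best ball is \<open>[2, 2 * x - 2]\<close>, giving the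
  condition \<open>2 * x - 2 < s\<close>. For \<open>x < 2\<close> it lies in \<open>[0, 2]\<close>,
  whose mass is below the threshold by the second assumption, so all such \<open>x\<close> belong to
  the superlevel set.\<close>

lemma weak_type_quantity_dyadic_2:
  assumes "s \<ge> 2" "cdf_fun s > 2 * cdf_fun 2"
  shows "weak_type_quantity dyadic_measure (return half_line 2) (1 / (cdf_fun s - cdf_fun 2))
    = ennreal (cdf_fun (1 + s / 2) / (cdf_fun s - cdf_fun 2))"
proof (rule weak_type_quantity_dyadic)
  have nn: "cdf_fun 2 \<ge> 0" by (simp add: cdf_fun_nonneg)
  then show pos: "cdf_fun s - cdf_fun 2 > 0" using assms by simp
  fix x :: real assume x: "x \<ge> 0" "x \<noteq> 2"
  show "emeasure dyadic_measure (half_ball x \<bar>x - 2\<bar>) < ennreal (cdf_fun s - cdf_fun 2)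
      \<longleftrightarrow> x < 1 + s / 2"
  proof (cases "x < 2")
    case True
    have "emeasure dyadic_measure (half_ball x \<bar>x - 2\<bar>) \<le> emeasure dyadic_measure {0..2}"
      using True by (intro emeasure_mono borel_half_line_sets) (auto simp: half_ball_def)
    also have "\<dots> = ennreal (cdf_fun 2)"
      by (simp add: emeasure_dyadic_Icc0)
    also have "\<dots> < ennreal (cdf_fun s - cdf_fun 2)"
      using assms nn by (simp add: ennreal_less_iff)
    finally show ?thesis using True assms by simp
  next
    case False
    then have "half_ball x \<bar>x - 2\<bar> = {2..2 * x - 2}"
      using x by (auto simp: half_ball_def abs_le_iff)
    moreover have "cdf_fun 2 \<le> cdf_fun (2 * x - 2)"
      using False x by (intro less_imp_le cdf_fun_strict_mono) auto
    ultimately show ?thesis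
      using False x assms pos
      by (auto simp: emeasure_dyadic_Icc ennreal_less_iff cdf_fun_less_iff)
  qed
qed (use assms in auto)

section \<open>Levels tending to zero\<close>

lemma filterlim_cdf_fun_at_top:
  "filterlim cdf_fun at_top at_top"
proof (rule filterlim_at_top_mono)
  show "filterlim (\<lambda>x. exp (log 2 x - 1)) at_top at_top"
    by real_asymp
  have "exp (log 2 x - 1) \<le> cdf_fun x" if "x \<ge> 1" for x
  proof -
    have "log 2 x \<ge> 0" using that by simp
    then have "log 2 x - 1 \<le> dyadic_level x" unfolding dyadic_level_def by linarith
    then have "exp (log 2 x - 1) \<le> exp (dyadic_level x)" by simp
    also have "\<dots> \<le> cdf_fun x"
      using dyadic_level_bounds[OF that] by (intro cdf_fun_ge_exp) auto
    finally show ?thesis .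
  qed
  then show "eventually (\<lambda>x. exp (log 2 x - 1) \<le> cdf_fun x) at_top"
    by (intro eventually_mono[OF eventually_ge_at_top[of 1]]) auto
qed

lemma filterlim_weak_type_levels:
  "filterlim (\<lambda>s. 1 / (cdf_fun s - c)) (at_right 0) at_top"
proof -
  have "filterlim (\<lambda>s. - c + cdf_fun s) at_top at_top"
    by (intro filterlim_tendsto_add_at_top[OF tendsto_const] filterlim_cdf_fun_at_top)
  then have "filterlim (\<lambda>s. inverse (cdf_fun s - c)) (at_right 0) at_top"
    by (intro filterlim_compose[OF filterlim_inverse_at_right_top]) simp
  then show ?thesis by (simp add: inverse_eq_divide)
qed

text \<open>Every small level has the form \<open>1 / (cdf_fun s - c)\<close> because
  \<open>cdf_fun\<close> attains all values from 1 on, and \<open>s\<close> is large by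
  monotonicity. Full limits, not just limits along sequences, can thus be computed in
  \<open>s\<close>.\<close>

lemma eventually_at_right_from_levels:
  assumes "eventually P at_top" and c: "c \<ge> 0"
  shows "eventually (\<lambda>l. \<exists>s. P s \<and> l = 1 / (cdf_fun s - c)) (at_right 0)"
proof -
  obtain N where N: "\<And>s. s \<ge> N \<Longrightarrow> P s"
    using assms(1) by (auto simp: eventually_at_top_linorder)
  \<comment> \<open>The bound 1 keeps \<open>1 / l + c\<close> among the attained values;
    \<open>max N 0\<close> keeps the comparison of arguments on the half line.\<close>
  define T where "T = max 1 (cdf_fun (max N 0))"
  have "T \<ge> 1" by (simp add: T_def)
  have "eventually (\<lambda>l. l < 1 / T) (at_right 0)"
    using \<open>T \<ge> 1\<close> by (intro order_tendstoD(2)[OF tendsto_ident_at]) auto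
  moreover have "eventually (\<lambda>l::real. 0 < l) (at_right 0)"
    by (rule eventually_at_right_less)
  ultimately show ?thesis
  proof eventually_elim
    case (elim l)
    then have "T < 1 / l" using \<open>T \<ge> 1\<close> by (simp add: field_simps)
    then obtain s where s: "s \<ge> 1" "cdf_fun s = 1 / l + c"
      using cdf_fun_attains[of "1 / l + c"] \<open>T \<ge> 1\<close> c by auto
    have "cdf_fun (max N 0) < cdf_fun s"
      using s \<open>T < 1 / l\<close> c by (simp add: T_def)
    then have "s \<ge> N" using s by (subst (asm) cdf_fun_less_iff) auto
    then show ?case using N[of s] s(2) by (intro exI[of _ s]) simp
  qed
qed

lemma weak_type_quantity_at_0:
  "(weak_type_quantity dyadic_measure (return half_line 0) \<longlongrightarrow> ennreal (exp (- 1))) (at_right 0)"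
proof (rule topological_tendstoI)
  fix S assume S: "open S" "ennreal (exp (- 1)) \<in> S"
  have "((\<lambda>s. ennreal (cdf_fun (s / 2) / cdf_fun s)) \<longlongrightarrow> ennreal (exp (- 1))) at_top"
    by (intro tendsto_ennrealI cdf_fun_half_limit)
  then have "eventually (\<lambda>s. ennreal (cdf_fun (s / 2) / cdf_fun s) \<in> S) at_top"
    using S by (rule topological_tendstoD)
  then have "eventually (\<lambda>s. weak_type_quantity dyadic_measure (return half_line 0) (1 / cdf_fun s) \<in> S) at_top"
    using eventually_gt_at_top[of 0] by eventually_elim (simp add: weak_type_quantity_dyadic_0)
  from eventually_at_right_from_levels[OF this, of 0]
  show "eventually (\<lambda>l. weak_type_quantity dyadic_measure (return half_line 0) l \<in> S) (at_right 0)"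
    by (auto elim: eventually_mono)
qed

section \<open>Upper and lower limits for the Dirac mass at 2\<close>

lemma eventually_level_2: "eventually (\<lambda>s. s \<ge> 2 \<and> cdf_fun s > 2 * cdf_fun 2) at_top"
  using filterlim_cdf_fun_at_top by (intro eventually_conj eventually_ge_at_top)
    (auto simp: filterlim_at_top_dense)

lemma tendsto_weak_type_2:
  assumes s: "filterlim s at_top sequentially"
    and lim: "(\<lambda>n. cdf_fun (1 + s n / 2) / (cdf_fun (s n) - cdf_fun 2)) \<longlonglongrightarrow> L"
  shows "(\<lambda>n. weak_type_quantity dyadic_measure (return half_line 2)
    (1 / (cdf_fun (s n) - cdf_fun 2))) \<longlonglongrightarrow> ennreal L"
proof (rule Lim_transform_eventually)
  show "(\<lambda>n. ennreal (cdf_fun (1 + s n / 2) / (cdf_fun (s n) - cdf_fun 2))) \<longlonglongrightarrow> ennreal L"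
    by (intro tendsto_ennrealI lim)
  show "eventually (\<lambda>n. ennreal (cdf_fun (1 + s n / 2) / (cdf_fun (s n) - cdf_fun 2))
      = weak_type_quantity dyadic_measure (return half_line 2) (1 / (cdf_fun (s n) - cdf_fun 2))) sequentially"
    using eventually_compose_filterlim[OF eventually_level_2 s]
    by eventually_elim (simp add: weak_type_quantity_dyadic_2)
qed

text \<open>Along \<open>s = 2 * 2 ^ k\<close> the numerator is evaluated at
  \<open>2 ^ k + 1\<close>, after the jump, and the denominator is \<open>exp (k + 1)\<close> up to
  a constant.\<close>

lemma Limsup_weak_type_2:
  "ennreal (exp (- 1)) < Limsup (at_right 0) (weak_type_quantity dyadic_measure (return half_line 2))"
proof -
  \<comment> \<open>Here \<open>ln 4 / ln 8\<close> is the limiting fraction of the increase of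
    \<open>piece k\<close> achieved within distance 1 of \<open>2 ^ k\<close>.\<close>
  define L :: real where "L = (1 + (exp 1 - 1) * (ln 4 / ln 8)) / exp 1"
  have "(\<lambda>k::nat. exp (real k) * (1 + (exp 1 - 1) * (ln (1 + 4 ^ k) / ln (1 + 8 ^ k)))
      / (exp (real (Suc k)) - cdf_fun 2)) \<longlonglongrightarrow> L"
    unfolding L_def by (real_asymp simp: field_simps)
  moreover have "cdf_fun (1 + 2 * 2 ^ k / 2) / (cdf_fun (2 * 2 ^ k) - cdf_fun 2)
      = exp (real k) * (1 + (exp 1 - 1) * (ln (1 + 4 ^ k) / ln (1 + 8 ^ k)))
      / (exp (real (Suc k)) - cdf_fun 2)" for k
    using cdf_fun_piece[of k "1 + 2 ^ k"] cdf_fun_power[of "Suc k"]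
    by (simp add: piece_def)
  ultimately have "(\<lambda>k::nat. cdf_fun (1 + 2 * 2 ^ k / 2) / (cdf_fun (2 * 2 ^ k) - cdf_fun 2)) \<longlonglongrightarrow> L"
    by presburger
  moreover have lim: "filterlim (\<lambda>k::nat. 2 * 2 ^ k :: real) at_top sequentially"
    by real_asymp
  ultimately have "ennreal L \<le> Limsup (at_right 0) (weak_type_quantity dyadic_measure (return half_line 2))"
    by (intro Limsup_ge_of_tendsto[OF filterlim_compose[OF filterlim_weak_type_levels[of "cdf_fun 2"] lim],
          where L = "ennreal L"] tendsto_weak_type_2) auto
  moreover have "ennreal (exp (- 1)) < ennreal L"
  proof -
    have "exp (-1) = 1 / exp (1::real)" by (simp add: exp_minus field_simps)
    also have "\<dots> < L" unfolding L_def by (intro divide_strict_right_mono) auto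
    finally show ?thesis by (simp add: ennreal_less_iff)
  qed
  ultimately show ?thesis by (rule less_le_trans[rotated])
qed

text \<open>The numerator is now evaluated exactly at a power of 2, before the jump, while
  \<open>s k\<close> is 2 short of the next dyadic endpoint, where the logarithm is already
  asymptotically full.\<close>

lemma Liminf_weak_type_2_le:
  "Liminf (at_right 0) (weak_type_quantity dyadic_measure (return half_line 2)) \<le> ennreal (exp (- 1))"
proof -
  \<comment> \<open>The extra factor 2 starts the sequence at exponent 1, so that
    \<open>s k \<ge> 2 ^ Suc k\<close> holds for every \<open>k\<close>.\<close>
  define s :: "nat \<Rightarrow> real" where "s k = 2 * (2 * 2 ^ k - 1)" for k
  have "(\<lambda>k::nat. exp (real (Suc k))
      / (exp (real (Suc k)) * (1 + (exp 1 - 1) *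
        (ln (1 + 8 ^ Suc k - 2 * 4 ^ Suc k) / ln (1 + 8 ^ Suc k))) - cdf_fun 2)) \<longlonglongrightarrow> exp (- 1)"
    by (real_asymp simp: exp_minus)
  moreover have "cdf_fun (1 + s k / 2) / (cdf_fun (s k) - cdf_fun 2)
      = exp (real (Suc k))
      / (exp (real (Suc k)) * (1 + (exp 1 - 1) *
        (ln (1 + 8 ^ Suc k - 2 * 4 ^ Suc k) / ln (1 + 8 ^ Suc k))) - cdf_fun 2)" for k
  proof -
    have "(1::real) \<le> 2 ^ k" by simp
    then have "cdf_fun (s k) = piece (Suc k) (s k)"
      by (intro cdf_fun_piece) (auto simp: s_def)
    moreover have "1 + 4 ^ Suc k * (s k - 2 ^ Suc k) = (1 + 8 ^ Suc k - 2 * 4 ^ Suc k :: real)"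
      by (simp add: s_def algebra_simps flip: power_mult_distrib)
    moreover have "1 + s k / 2 = 2 ^ Suc k" by (simp add: s_def field_simps)
    ultimately show ?thesis
      by (simp only: piece_def cdf_fun_power)
  qed
  ultimately have "(\<lambda>k. cdf_fun (1 + s k / 2) / (cdf_fun (s k) - cdf_fun 2)) \<longlonglongrightarrow> exp (- 1)"
    by presburger
  moreover have lim: "filterlim s at_top sequentially"
    unfolding s_def by real_asymp
  ultimately show ?thesis
    by (intro Liminf_le_of_tendsto[OF filterlim_compose[OF filterlim_weak_type_levels[of "cdf_fun 2"] lim],
          where L = "ennreal (exp (- 1))"] tendsto_weak_type_2) auto
qed

text \<open>For the same \<open>s\<close> the quotient for the mass at 2 has a larger numerator and
  a smaller denominator than the one for the mass at 0, whose limit is known.\<close>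

lemma Liminf_weak_type_2_ge:
  "ennreal (exp (- 1)) \<le> Liminf (at_right 0) (weak_type_quantity dyadic_measure (return half_line 2))"
proof (subst le_Liminf_iff, intro allI impI)
  fix y :: ennreal assume y: "y < ennreal (exp (- 1))"
  have "((\<lambda>s. ennreal (cdf_fun (s / 2) / cdf_fun s)) \<longlongrightarrow> ennreal (exp (- 1))) at_top"
    by (intro tendsto_ennrealI cdf_fun_half_limit)
  from order_tendstoD(1)[OF this y]
  have "eventually (\<lambda>s. y < ennreal (cdf_fun (s / 2) / cdf_fun s)) at_top" .
  then have "eventually (\<lambda>s. y < weak_type_quantity dyadic_measure (return half_line 2)
      (1 / (cdf_fun s - cdf_fun 2))) at_top"
    using eventually_level_2
  proof eventually_elim
    case (elim s)
    have nn: "cdf_fun 2 \<ge> 0" by (simp add: cdf_fun_nonneg)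
    have "cdf_fun (s / 2) / cdf_fun s \<le> cdf_fun (1 + s / 2) / (cdf_fun s - cdf_fun 2)"
      using elim nn by (intro frac_le less_imp_le[OF cdf_fun_strict_mono] cdf_fun_nonneg) auto
    then show ?case
      using elim by (auto simp: weak_type_quantity_dyadic_2 intro: less_le_trans ennreal_leI)
  qed
  from eventually_at_right_from_levels[OF this, of "cdf_fun 2"]
  show "eventually (\<lambda>l. y < weak_type_quantity dyadic_measure (return half_line 2) l) (at_right 0)"
    by (auto simp: cdf_fun_nonneg elim!: eventually_mono)
qed

theorem proposition3p6:
  "\<exists>\<mu> :: real measure.
     sets \<mu> = sets half_line \<and>
     (\<forall>A \<in> sets \<mu>. bounded A \<longrightarrow> emeasure \<mu> A < \<infinity>) \<and>
     measure_support \<mu> \<noteq> {} \<and>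
     absolutely_continuous (restrict_space lborel {0..}) \<mu> \<and>
     Limsup (at_right 0) (weak_type_quantity \<mu> (return half_line 2)) > ennreal (exp (- 1)) \<and>
     Liminf (at_right 0) (weak_type_quantity \<mu> (return half_line 2)) = ennreal (exp (- 1)) \<and>
     (weak_type_quantity \<mu> (return half_line 0) \<longlongrightarrow> ennreal (exp (- 1))) (at_right 0)"
proof (intro exI[of _ dyadic_measure] conjI ballI impI)
  fix A assume A: "A \<in> sets dyadic_measure" "bounded A"
  then obtain b where b: "\<And>x. x \<in> A \<Longrightarrow> \<bar>x\<bar> \<le> b"
    by (auto simp: bounded_iff)
  have "A \<subseteq> {0..}"
    using A(1) by (auto simp: sets_dyadic_measure sets_restrict_space)
  \<comment> \<open>The bound \<open>b\<close> may be negative when \<open>A\<close> is empty, hence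
    the maximum.\<close>
  then have "A \<subseteq> {0..max 0 b}"
    using b by (force simp: max_def)
  then have "emeasure dyadic_measure A \<le> emeasure dyadic_measure {0..max 0 b}"
    by (intro emeasure_mono borel_half_line_sets) auto
  also have "\<dots> < \<infinity>" by (simp add: emeasure_dyadic_Icc0)
  finally show "emeasure dyadic_measure A < \<infinity>" .
next
  have "0 \<in> measure_support dyadic_measure"
    by (simp add: measure_support_def half_ball_dyadic_pos)
  then show "measure_support dyadic_measure \<noteq> {}" by blast
next
  show "absolutely_continuous (restrict_space lborel {0..}) dyadic_measure"
    unfolding dyadic_measure_def
    by (intro absolutely_continuousI_density) (auto intro!: measurable_restrict_space1)
qed (fact sets_dyadic_measure Limsup_weak_type_2 weak_type_quantity_at_0
    antisym[OF Liminf_weak_type_2_le Liminf_weak_type_2_ge])+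

end
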